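(* Let $(M,\langle\,,\rangle)$ be a Riemannian manifold with Levi-Civita connection $\nabla^0$, and let $\mathcal{V}$ be an anti-torqued vector field on $M$ of constant length. Then $\mathcal{V}$ is a unit geodesic vector field, i.e. $|\mathcal{V}|=1$ and $\nabla^0_{\mathcal{V}}\mathcal{V}=0$ on $M$.
   Context: Let $(M,\langle\,,\rangle)$ be a Riemannian manifold with Levi-Civita connection $\nabla^0$, and let $\mathfrak{X}(M)$ denote the smooth vector fields on $M$. A nowhere zero smooth vector field $\mathcal{V}$ on $M$ is called torse-forming if there are a smooth function $f$ (the conformal scalar) and a $1$-form $\omega$ (the generating form) on $M$ with $\nabla^0_X\mathcal{V}=fX+\omega(X)\mathcal{V}$ for all $X\in\mathfrak{X}(M)$. It is called proper if neither $f$ nor $\omega$ vanishes identically on any nonempty open subset of $M$. Let $\nu$ be the $1$-form dual to $\mathcal{V}$, $\nu(X)=\langle X,\mathcal{V}\rangle$. An anti-torqued vector field is a proper torse-forming vector field with $\omega=-f\nu$, i.e. a nowhere zero vector field satisfying $$\nabla^0_X\mathcal{V}=f\,(X-\nu(X)\mathcal{V})\quad\text{for all }X\in\mathfrak{X}(M),$$ with $f$ (equivalently $\omega$) not identically zero on any nonempty open set (in particular $\mathcal{V}$ is not parallel). *)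

theory Defs
  imports "HOL-Analysis.Analysis"
begin

section \<open>Smooth maps between Euclidean spaces\<close>

text \<open>The set \<open>S\<close> is meant to be open. Being \<open>C\<^sup>k\<close> is expressed by iterating directional derivatives.\<close>

fun Ck_on :: "nat \<Rightarrow> 'e::euclidean_space set \<Rightarrow> ('e \<Rightarrow> 'f::real_normed_vector) \<Rightarrow> bool" where
  "Ck_on 0 S f \<longleftrightarrow> continuous_on S f"
| "Ck_on (Suc k) S f \<longleftrightarrow>
     (\<forall>x\<in>S. f differentiable (at x)) \<and>
     (\<forall>v. Ck_on k S (\<lambda>x. frechet_derivative f (at x) v))"

definition smooth_on :: "'e::euclidean_space set \<Rightarrow> ('e \<Rightarrow> 'f::real_normed_vector) \<Rightarrow> bool" where
  "smooth_on S f \<longleftrightarrow> (\<forall>k. Ck_on k S f)"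


section \<open>Smooth manifolds\<close>

text \<open>
  A chart is a pair of a domain and a coordinate map, the values of the map outside the domain being
  irrelevant. The atlas need not be maximal: the notions below are the same for an atlas and for
  the maximal atlas containing it. The points of the manifold are the elements of
  \<open>topspace (mtop M)\<close>; connectedness is not assumed.
\<close>

record ('a, 'e) mfd =
  mtop :: "'a topology"
  atlas :: "('a set \<times> ('a \<Rightarrow> 'e)) set"

abbreviation pts :: "('a, 'e) mfd \<Rightarrow> 'a set" where
  "pts M \<equiv> topspace (mtop M)"

definition is_chart :: "'a topology \<Rightarrow> 'a set \<Rightarrow> ('a \<Rightarrow> 'e::euclidean_space) \<Rightarrow> bool" where
  "is_chart T U \<phi> \<longleftrightarrow> openin T U \<and> open (\<phi> ` U) \<and>
     homeomorphic_map (subtopology T U) (top_of_set (\<phi> ` U)) \<phi>"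

definition smooth_manifold :: "('a, 'e::euclidean_space) mfd \<Rightarrow> bool" where
  "smooth_manifold M \<longleftrightarrow>
     Hausdorff_space (mtop M) \<and> second_countable (mtop M) \<and>
     (\<forall>(U, \<phi>)\<in>atlas M. is_chart (mtop M) U \<phi>) \<and>
     (\<Union>(U, \<phi>)\<in>atlas M. U) = pts M \<and>
     (\<forall>(U, \<phi>)\<in>atlas M. \<forall>(W, \<psi>)\<in>atlas M. smooth_on (\<phi> ` (U \<inter> W)) (\<psi> \<circ> inv_into U \<phi>))"

text \<open>The values of a smooth function outside \<open>pts M\<close> are unconstrained.\<close>

definition smooth_funs :: "('a, 'e::euclidean_space) mfd \<Rightarrow> ('a \<Rightarrow> real) set" where
  "smooth_funs M = {f. \<forall>(U, \<phi>)\<in>atlas M. smooth_on (\<phi> ` U) (f \<circ> inv_into U \<phi>)}"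


section \<open>Tangent vectors and vector fields\<close>

text \<open>
  Tangent vectors at \<open>p\<close> are the derivations at \<open>p\<close> of the algebra of smooth functions.
  They are extended by 0 to non-smooth functions, so that equality of tangent vectors is equality
  in HOL. By the Leibniz rule a derivation vanishes on every function that is 0 on \<open>pts M\<close>
  (write it as its own product with the indicator function of the complement), so the values
  of smooth functions outside \<open>pts M\<close> do not matter.
\<close>

type_synonym 'a tvec = "('a \<Rightarrow> real) \<Rightarrow> real"

definition tvec_zero :: "'a tvec" where
  "tvec_zero = (\<lambda>f. 0)"

definition tvec_lincomb :: "real \<Rightarrow> 'a tvec \<Rightarrow> real \<Rightarrow> 'a tvec \<Rightarrow> 'a tvec" where
  "tvec_lincomb a v b w = (\<lambda>f. a * v f + b * w f)"

definition tangent_space :: "('a, 'e::euclidean_space) mfd \<Rightarrow> 'a \<Rightarrow> 'a tvec set" where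
  "tangent_space M p = {v.
     (\<forall>f\<in>smooth_funs M. \<forall>h\<in>smooth_funs M. \<forall>a b.
        v (\<lambda>x. a * f x + b * h x) = a * v f + b * v h) \<and>
     (\<forall>f\<in>smooth_funs M. \<forall>h\<in>smooth_funs M.
        v (\<lambda>x. f x * h x) = v f * h p + f p * v h) \<and>
     (\<forall>f. f \<notin> smooth_funs M \<longrightarrow> v f = 0)}"

text \<open>
  Smooth vector fields: \<open>X p\<close> is tangent at \<open>p\<close>, and \<open>X f\<close> is smooth for each smooth \<open>f\<close>.
  Fields are extended by zero outside \<open>pts M\<close>, so that an operator on fields
  (such as a connection) depends on nothing else.
\<close>

definition vector_fields :: "('a, 'e::euclidean_space) mfd \<Rightarrow> ('a \<Rightarrow> 'a tvec) set" where
  "vector_fields M = {X.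
     (\<forall>p\<in>pts M. X p \<in> tangent_space M p) \<and>
     (\<forall>p. p \<notin> pts M \<longrightarrow> X p = tvec_zero) \<and>
     (\<forall>f\<in>smooth_funs M. (\<lambda>p. X p f) \<in> smooth_funs M)}"

definition field_lincomb ::
  "('a \<Rightarrow> real) \<Rightarrow> ('a \<Rightarrow> 'a tvec) \<Rightarrow> ('a \<Rightarrow> real) \<Rightarrow> ('a \<Rightarrow> 'a tvec) \<Rightarrow> 'a \<Rightarrow> 'a tvec" where
  "field_lincomb f X h Y = (\<lambda>p. tvec_lincomb (f p) (X p) (h p) (Y p))"

definition lie_bracket :: "('a \<Rightarrow> 'a tvec) \<Rightarrow> ('a \<Rightarrow> 'a tvec) \<Rightarrow> 'a \<Rightarrow> 'a tvec" where
  "lie_bracket X Y = (\<lambda>p f. X p (\<lambda>q. Y q f) - Y p (\<lambda>q. X q f))"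

definition one_forms :: "('a, 'e::euclidean_space) mfd \<Rightarrow> ('a \<Rightarrow> 'a tvec \<Rightarrow> real) set" where
  "one_forms M = {\<omega>.
     (\<forall>p\<in>pts M. \<forall>v\<in>tangent_space M p. \<forall>w\<in>tangent_space M p. \<forall>a b.
        \<omega> p (tvec_lincomb a v b w) = a * \<omega> p v + b * \<omega> p w) \<and>
     (\<forall>X\<in>vector_fields M. (\<lambda>p. \<omega> p (X p)) \<in> smooth_funs M)}"


section \<open>Riemannian metrics and the Levi-Civita connection\<close>

type_synonym 'a metric_tensor = "'a \<Rightarrow> 'a tvec \<Rightarrow> 'a tvec \<Rightarrow> real"

definition riemannian_metric ::
  "('a, 'e::euclidean_space) mfd \<Rightarrow> 'a metric_tensor \<Rightarrow> bool" where
  "riemannian_metric M g \<longleftrightarrow>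
     (\<forall>p\<in>pts M. \<forall>u\<in>tangent_space M p. \<forall>v\<in>tangent_space M p. \<forall>w\<in>tangent_space M p. \<forall>a b.
        g p (tvec_lincomb a u b v) w = a * g p u w + b * g p v w) \<and>
     (\<forall>p\<in>pts M. \<forall>v\<in>tangent_space M p. \<forall>w\<in>tangent_space M p. g p v w = g p w v) \<and>
     (\<forall>p\<in>pts M. \<forall>v\<in>tangent_space M p. v \<noteq> tvec_zero \<longrightarrow> g p v v > 0) \<and>
     (\<forall>X\<in>vector_fields M. \<forall>Y\<in>vector_fields M. (\<lambda>p. g p (X p) (Y p)) \<in> smooth_funs M)"

definition riemannian_manifold ::
  "('a, 'e::euclidean_space) mfd \<Rightarrow> 'a metric_tensor \<Rightarrow> bool" where
  "riemannian_manifold M g \<longleftrightarrow> smooth_manifold M \<and> riemannian_metric M g"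

type_synonym 'a connection = "('a \<Rightarrow> 'a tvec) \<Rightarrow> ('a \<Rightarrow> 'a tvec) \<Rightarrow> ('a \<Rightarrow> 'a tvec)"

text \<open>\<open>D X Y\<close> stands for the covariant derivative of \<open>Y\<close> along \<open>X\<close>.\<close>

definition affine_connection ::
  "('a, 'e::euclidean_space) mfd \<Rightarrow> 'a connection \<Rightarrow> bool" where
  "affine_connection M D \<longleftrightarrow>
     (\<forall>X\<in>vector_fields M. \<forall>Y\<in>vector_fields M. D X Y \<in> vector_fields M) \<and>
     (\<forall>f\<in>smooth_funs M. \<forall>h\<in>smooth_funs M.
      \<forall>X\<in>vector_fields M. \<forall>Y\<in>vector_fields M. \<forall>Z\<in>vector_fields M.
        D (field_lincomb f X h Y) Z = field_lincomb f (D X Z) h (D Y Z)) \<and>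
     (\<forall>a b. \<forall>X\<in>vector_fields M. \<forall>Y\<in>vector_fields M. \<forall>Z\<in>vector_fields M.
        D X (field_lincomb (\<lambda>_. a) Y (\<lambda>_. b) Z) =
          field_lincomb (\<lambda>_. a) (D X Y) (\<lambda>_. b) (D X Z)) \<and>
     (\<forall>f\<in>smooth_funs M. \<forall>X\<in>vector_fields M. \<forall>Y\<in>vector_fields M.
        D X (\<lambda>p \<phi>. f p * Y p \<phi>) = field_lincomb (\<lambda>p. X p f) Y f (D X Y))"

definition torsion_free :: "('a, 'e::euclidean_space) mfd \<Rightarrow> 'a connection \<Rightarrow> bool" where
  "torsion_free M D \<longleftrightarrow> (\<forall>X\<in>vector_fields M. \<forall>Y\<in>vector_fields M.
     (\<lambda>p \<phi>. D X Y p \<phi> - D Y X p \<phi>) = lie_bracket X Y)"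

definition metric_compatible ::
  "('a, 'e::euclidean_space) mfd \<Rightarrow> 'a metric_tensor \<Rightarrow> 'a connection \<Rightarrow> bool" where
  "metric_compatible M g D \<longleftrightarrow>
     (\<forall>X\<in>vector_fields M. \<forall>Y\<in>vector_fields M. \<forall>Z\<in>vector_fields M. \<forall>p\<in>pts M.
        X p (\<lambda>q. g q (Y q) (Z q)) = g p (D X Y p) (Z p) + g p (Y p) (D X Z p))"

definition levi_civita_connection ::
  "('a, 'e::euclidean_space) mfd \<Rightarrow> 'a metric_tensor \<Rightarrow> 'a connection \<Rightarrow> bool" where
  "levi_civita_connection M g D \<longleftrightarrow>
     affine_connection M D \<and> torsion_free M D \<and> metric_compatible M g D"


section \<open>Torse-forming and anti-torqued vector fields\<close>

text \<open>\<open>V\<close> is torse-forming with conformal scalar \<open>f\<close> and generating form \<open>\<omega>\<close>.\<close>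

definition torse_forming ::
  "('a, 'e::euclidean_space) mfd \<Rightarrow> 'a connection \<Rightarrow> ('a \<Rightarrow> 'a tvec) \<Rightarrow>
   ('a \<Rightarrow> real) \<Rightarrow> ('a \<Rightarrow> 'a tvec \<Rightarrow> real) \<Rightarrow> bool" where
  "torse_forming M D V f \<omega> \<longleftrightarrow>
     V \<in> vector_fields M \<and> (\<forall>p\<in>pts M. V p \<noteq> tvec_zero) \<and>
     f \<in> smooth_funs M \<and> \<omega> \<in> one_forms M \<and>
     (\<forall>X\<in>vector_fields M. D X V = field_lincomb f X (\<lambda>p. \<omega> p (X p)) V)"

definition proper_torse_forming ::
  "('a, 'e::euclidean_space) mfd \<Rightarrow> 'a connection \<Rightarrow> ('a \<Rightarrow> 'a tvec) \<Rightarrow>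
   ('a \<Rightarrow> real) \<Rightarrow> ('a \<Rightarrow> 'a tvec \<Rightarrow> real) \<Rightarrow> bool" where
  "proper_torse_forming M D V f \<omega> \<longleftrightarrow> torse_forming M D V f \<omega> \<and>
     (\<forall>U. openin (mtop M) U \<and> U \<noteq> {} \<longrightarrow>
        \<not> (\<forall>p\<in>U. f p = 0) \<and>
        \<not> (\<forall>p\<in>U. \<forall>v\<in>tangent_space M p. \<omega> p v = 0))"

definition dual_form :: "'a metric_tensor \<Rightarrow> ('a \<Rightarrow> 'a tvec) \<Rightarrow> 'a \<Rightarrow> 'a tvec \<Rightarrow> real" where
  "dual_form g V = (\<lambda>p v. g p v (V p))"

definition anti_torqued ::
  "('a, 'e::euclidean_space) mfd \<Rightarrow> 'a metric_tensor \<Rightarrow> 'a connection \<Rightarrow>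
   ('a \<Rightarrow> 'a tvec) \<Rightarrow> bool" where
  "anti_torqued M g D V \<longleftrightarrow> (\<exists>f \<omega>. proper_torse_forming M D V f \<omega> \<and>
     (\<forall>p\<in>pts M. \<forall>v\<in>tangent_space M p. \<omega> p v = - f p * dual_form g V p v))"

definition field_length :: "'a metric_tensor \<Rightarrow> ('a \<Rightarrow> 'a tvec) \<Rightarrow> 'a \<Rightarrow> real" where
  "field_length g V p = sqrt (g p (V p) (V p))"

definition constant_length ::
  "('a, 'e::euclidean_space) mfd \<Rightarrow> 'a metric_tensor \<Rightarrow> ('a \<Rightarrow> 'a tvec) \<Rightarrow> bool" where
  "constant_length M g V \<longleftrightarrow> (\<exists>c. \<forall>p\<in>pts M. field_length g V p = c)"

end

theory Submission
  imports Defs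
begin

text \<open>
  Since \<open>\<langle>V, V\<rangle> = c\<^sup>2\<close> is constant, metric compatibility gives
  \<open>0 = V \<langle>V, V\<rangle> = 2 \<langle>\<nabla>\<^sub>V V, V\<rangle> = 2 f (1 - c\<^sup>2) c\<^sup>2\<close>. As \<open>V\<close> has no zeros and \<open>f\<close> is nonzero somewhere,
  \<open>c\<^sup>2 = 1\<close>, and then \<open>\<nabla>\<^sub>V V = f (1 - c\<^sup>2) V = 0\<close>.
\<close>

text \<open>Near each point of the open set \<open>S\<close> the function agrees with a constant, so
  its derivative is 0 throughout \<open>S\<close>, again a constant. The value changes from
  \<open>c\<close> to 0, hence the induction over arbitrary \<open>f\<close> and
  \<open>c\<close>.\<close>

lemma Ck_on_const:
  fixes f :: "'e::euclidean_space \<Rightarrow> 'f::real_normed_vector"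
  assumes "open S" "\<And>x. x \<in> S \<Longrightarrow> f x = c"
  shows "Ck_on k S f"
  using assms(2)
proof (induction k arbitrary: f c)
  case 0
  then show ?case
    by (simp cong: continuous_on_cong)
next
  case (Suc k)
  have deriv: "(f has_derivative (\<lambda>_. 0)) (at x)" if "x \<in> S" for x
    by (rule has_derivative_transform_within_open[OF has_derivative_const \<open>open S\<close> that])
      (simp add: Suc.prems)
  then have "frechet_derivative f (at x) = (\<lambda>_. 0)" if "x \<in> S" for x
    using frechet_derivative_at[of f "\<lambda>_. 0" x] that by simp
  then have "Ck_on k S (\<lambda>x. frechet_derivative f (at x) v)" for v
    by (intro Suc.IH[where c = 0]) simp
  with deriv show ?case
    by (auto simp: differentiable_def)
qed

text \<open>Chart domains lie in \<open>pts M\<close>, so values elsewhere never enter a coordinate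
  expression.\<close>

lemma smooth_funs_const:
  assumes M: "smooth_manifold M" and f: "\<And>p. p \<in> pts M \<Longrightarrow> f p = c"
  shows "f \<in> smooth_funs M"
proof -
  have "smooth_on (\<phi> ` U) (f \<circ> inv_into U \<phi>)" if "(U, \<phi>) \<in> atlas M" for U \<phi>
  proof -
    have "is_chart (mtop M) U \<phi>"
      using M that by (auto simp: smooth_manifold_def)
    then have "open (\<phi> ` U)" "U \<subseteq> pts M"
      by (auto simp: is_chart_def dest: openin_subset)
    then show ?thesis
      unfolding smooth_on_def
      by (auto intro!: Ck_on_const[where c = c] f simp: inv_into_into subset_iff)
  qed
  then show ?thesis
    by (auto simp: smooth_funs_def)
qed

text \<open>If \<open>e\<close> is idempotent with \<open>e p = 1\<close>, the Leibniz rule reads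
  \<open>v e = 2 * v e\<close>, so \<open>v e = 0\<close>. The same rule for the product of
  \<open>f\<close> and \<open>e\<close>, which is \<open>c\<close> times \<open>e\<close>, then
  gives \<open>v f = c * v e = 0\<close>.\<close>

lemma tangent_space_const:
  assumes M: "smooth_manifold M" and p: "p \<in> pts M" and v: "v \<in> tangent_space M p"
    and f: "\<And>q. q \<in> pts M \<Longrightarrow> f q = c"
  shows "v f = 0"
proof -
  \<comment> \<open>The constant 1 is cut off outside \<open>pts M\<close> because the values of \<open>f\<close> there are arbitrary.\<close>
  define e :: "'a \<Rightarrow> real" where "e = indicator (pts M)"
  have fs: "f \<in> smooth_funs M" and es: "e \<in> smooth_funs M"
    using M f smooth_funs_const[of M e 1] by (auto simp: e_def intro: smooth_funs_const)
  have leibniz: "v (\<lambda>x. h x * e x) = v h * e p + h p * v e" if "h \<in> smooth_funs M" for h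
    using v es that by (simp add: tangent_space_def)
  have "(\<lambda>x. e x * e x) = e" "e p = 1"
    using p by (auto simp: e_def indicator_def)
  then have ve: "v e = 0"
    using leibniz[OF es] by simp
  have "(\<lambda>x. f x * e x) = (\<lambda>x. c * e x + 0 * e x)"
    using f by (auto simp: e_def indicator_def)
  moreover have "v (\<lambda>x. c * e x + 0 * e x) = c * v e + 0 * v e"
    using v es unfolding tangent_space_def by blast
  ultimately show ?thesis
    using leibniz[OF fs] ve \<open>e p = 1\<close> by simp
qed

theorem proposition3p5:
  fixes M :: "('a, 'e::euclidean_space) mfd"
    and g :: "'a metric_tensor"
    and D :: "'a connection"
    and V :: "'a \<Rightarrow> 'a tvec"
  assumes "riemannian_manifold M g"
    and "levi_civita_connection M g D"
    and "anti_torqued M g D V"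
    and "constant_length M g V"
  shows "(\<forall>p\<in>pts M. field_length g V p = 1) \<and> (\<forall>p\<in>pts M. D V V p = tvec_zero)"
proof -
  have M: "smooth_manifold M" and g: "riemannian_metric M g"
    using assms(1) by (auto simp: riemannian_manifold_def)
  have DV: "affine_connection M D" and compat: "metric_compatible M g D"
    using assms(2) by (auto simp: levi_civita_connection_def)
  obtain f \<omega> where proper: "proper_torse_forming M D V f \<omega>"
    and \<omega>: "\<And>p v. p \<in> pts M \<Longrightarrow> v \<in> tangent_space M p \<Longrightarrow> \<omega> p v = - f p * dual_form g V p v"
    using assms(3) by (auto simp: anti_torqued_def)
  obtain c where c: "\<And>p. p \<in> pts M \<Longrightarrow> field_length g V p = c"
    using assms(4) by (auto simp: constant_length_def)
  have V: "V \<in> vector_fields M" and nz: "\<And>p. p \<in> pts M \<Longrightarrow> V p \<noteq> tvec_zero"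
    and torse: "D V V = field_lincomb f V (\<lambda>p. \<omega> p (V p)) V"
    using proper by (auto simp: proper_torse_forming_def torse_forming_def)
  have Vt: "V p \<in> tangent_space M p" if "p \<in> pts M" for p
    using V that by (auto simp: vector_fields_def)
  have pos: "g p (V p) (V p) > 0" if "p \<in> pts M" for p
    using g Vt[OF that] nz[OF that] that by (auto simp: riemannian_metric_def)
  \<comment> \<open>Positivity matters here: \<open>sqrt\<close> is an odd function on the reals, so
    squaring it recovers its argument only when that is nonnegative.\<close>
  have gVV: "g p (V p) (V p) = c\<^sup>2" if "p \<in> pts M" for p
    using c[OF that] pos[OF that] by (auto simp: field_length_def)
  have DVV: "D V V p = tvec_lincomb (f p) (V p) (- f p * c\<^sup>2) (V p)" if "p \<in> pts M" for p
    using \<omega>[OF that Vt[OF that]] gVV[OF that]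
    by (simp add: torse field_lincomb_def dual_form_def)
  have key: "f p * (1 - c\<^sup>2) * c\<^sup>2 = 0" if p: "p \<in> pts M" for p
  proof -
    have Dt: "D V V p \<in> tangent_space M p"
      using DV V p by (auto simp: affine_connection_def vector_fields_def)
    have "0 = V p (\<lambda>q. g q (V q) (V q))"
      using tangent_space_const[OF M p Vt[OF p] gVV] by simp
    also have "\<dots> = g p (D V V p) (V p) + g p (V p) (D V V p)"
      using compat V p by (auto simp: metric_compatible_def)
    \<comment> \<open>Linearity of \<open>g\<close> is postulated in the first slot only, so the
      derivative is moved there.\<close>
    also have "g p (V p) (D V V p) = g p (D V V p) (V p)"
      using g p Vt[OF p] Dt unfolding riemannian_metric_def by blast
    also have "g p (D V V p) (V p) = f p * g p (V p) (V p) + - f p * c\<^sup>2 * g p (V p) (V p)"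
      using g p Vt[OF p] unfolding DVV[OF p] riemannian_metric_def by blast
    finally show ?thesis
      by (auto simp: gVV[OF p] algebra_simps)
  qed
  \<comment> \<open>The manifold may be empty, leaving \<open>c\<close> arbitrary; hence the
    condition on \<open>p\<close>. Since \<open>c\<close> is the same at all points, it suffices to
    cancel \<open>f\<close> in \<open>key\<close> at one point \<open>q\<close>, which properness on
    the whole space supplies.\<close>
  have c2: "c\<^sup>2 = 1" if "p \<in> pts M" for p
  proof -
    have "openin (mtop M) (pts M)" "pts M \<noteq> {}"
      using that by auto
    then obtain q where q: "q \<in> pts M" "f q \<noteq> 0"
      using proper unfolding proper_torse_forming_def by blast
    then show ?thesis
      using key[OF q(1)] gVV[OF q(1)] pos[OF q(1)] by auto
  qed
  have "field_length g V p = 1" "D V V p = tvec_zero" if p: "p \<in> pts M" for p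
    using gVV[OF p] c2[OF p] DVV[OF p]
    by (simp_all add: field_length_def tvec_lincomb_def tvec_zero_def)
  then show ?thesis
    by blast
qed

end
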